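(* Let $\mathcal{B}$ be a basis of a real Banach space $\mathbb{X}$. (A) The following assertions are equivalent: (i) There is a constant $c>0$ such that $$c\,\|x\|\le\liminf_{m\to+\infty}\mathcal{D}_m^*(x)\le\limsup_{m\to+\infty}\mathcal{D}_m^*(x)\le\|x\|\quad\text{for every }x\in\mathbb{X}.$$ (ii) $h_l^*(m)$ and $h_r^*(m)$ are comparable. Moreover, if $\mathcal{B}$ is monotone and $h_l^*(m)\to+\infty$ as $m\to+\infty$, then $\lim_{m\to+\infty}\mathcal{D}_m^*(x)=\|x\|$ for every $x\in\mathbb{X}$. (B) The same holds with $\mathcal{D}_m^*(x),h_l^*(m),h_r^*(m)$ replaced respectively by $\mathcal{D}_m(x),h_l(m),h_r(m)$. That is, the following assertions are equivalent: (i') There is a constant $c>0$ such that $$c\,\|x\|\le\liminf_{m\to+\infty}\mathcal{D}_m(x)\le\limsup_{m\to+\infty}\mathcal{D}_m(x)\le\|x\|\quad\text{for every }x\in\mathbb{X}.$$ (ii') $h_l(m)$ and $h_r(m)$ are comparable. Moreover, if $\mathcal{B}$ is monotone and $h_l(m)\to+\infty$ as $m\to+\infty$, then $\lim_{m\to+\infty}\mathcal{D}_m(x)=\|x\|$ for every $x\in\mathbb{X}$.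
   Context: Let $(\mathbb{X},\|\cdot\|)$ be a real Banach space. A "basis" of $\mathbb{X}$ means a semi-normalized Schauder basis $\mathcal{B}=(e_n)_{n=1}^{\infty}$ with biorthogonal functionals $(e_n^* )_{n=1}^\infty\subset\mathbb{X}^*$, i.e.: (i) there exist $a,b>0$ with $a\le\|e_n\|,\|e_n^*\|\le b$ for all $n\in\mathbb{N}$; (ii) $e_k^*(e_n)=\delta_{kn}$ for all $k,n$; (iii) the projections $P_m(x)=\sum_{n=1}^m e_n^*(x)e_n$ satisfy $\lim_m\|P_m(x)-x\|=0$ for every $x\in\mathbb{X}$. The basis constant is $K_b=\sup_m\|P_m\|<\infty$, and $\mathcal{B}$ is called monotone if $K_b=1$. For a finite set $A\subset\mathbb{N}$ and signs $\varepsilon=(\varepsilon_n)$ with $|\varepsilon_n|=1$ for all $n$ (written $|\varepsilon|=1$; here $\varepsilon_n\in\{\pm1\}$), put $\mathbf{1}_A=\sum_{n\in A}e_n$ and $\mathbf{1}_{\varepsilon A}=\sum_{n\in A}\varepsilon_n e_n$. Denote by $|A|$ the cardinality of $A$. For $x\in\mathbb{X}$ and $m\in\mathbb{N}$ define $$\mathcal{D}_m(x)=\inf\{\|x-\alpha\mathbf{1}_A\|:\alpha\in\mathbb{R},\ A\subset\mathbb{N},\ |A|=m\},$$ $$\mathcal{D}_m^*(x)=\inf\{\|x-\alpha\mathbf{1}_{\varepsilon A}\|:\alpha\in\mathbb{R},\ A\subset\mathbb{N},\ |A|=m,\ |\varepsilon|=1\}.$$ The democracy functions are $h_l(m)=\inf_{|A|=m}\|\mathbf{1}_A\|$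 and $h_r(m)=\sup_{|A|=m}\|\mathbf{1}_A\|$; the superdemocracy functions are $h_l^*(m)=\inf_{|A|=m,|\varepsilon|=1}\|\mathbf{1}_{\varepsilon A}\|$ and $h_r^*(m)=\sup_{|A|=m,|\varepsilon|=1}\|\mathbf{1}_{\varepsilon A}\|$ ($m\in\mathbb{N}$). The functions $h_l^*(m)$ and $h_r^*(m)$ (resp. $h_l(m)$ and $h_r(m)$) are comparable if either both are bounded or both diverge to infinity as $m\to+\infty$. *)

theory Defs
  imports "HOL-Analysis.Analysis"
begin

text \<open>
  Sequences are indexed from 0: \<open>e n\<close> is the basis vector \<open>e\<^sub>n\<^sub>+\<^sub>1\<close>, so the partial sum
  \<open>P\<^sub>m\<close> runs over the indices below \<open>m\<close>, and \<open>P\<^sub>0 = 0\<close>.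
\<close>

definition partial_sum_proj ::
    "(nat \<Rightarrow> 'a::real_normed_vector) \<Rightarrow> (nat \<Rightarrow> 'a \<Rightarrow>\<^sub>L real) \<Rightarrow> nat \<Rightarrow> 'a \<Rightarrow> 'a" where
  "partial_sum_proj e es m x = (\<Sum>n<m. blinfun_apply (es n) x *\<^sub>R e n)"

definition seminormalized_schauder_basis ::
    "(nat \<Rightarrow> 'a::real_normed_vector) \<Rightarrow> (nat \<Rightarrow> 'a \<Rightarrow>\<^sub>L real) \<Rightarrow> bool" where
  "seminormalized_schauder_basis e es \<longleftrightarrow>
     (\<exists>a b. 0 < a \<and> 0 < b \<and>
        (\<forall>n. a \<le> norm (e n) \<and> norm (e n) \<le> b \<and> a \<le> norm (es n) \<and> norm (es n) \<le> b)) \<and>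
     (\<forall>k n. blinfun_apply (es k) (e n) = (if k = n then 1 else 0)) \<and>
     (\<forall>x. (\<lambda>m. norm (partial_sum_proj e es m x - x)) \<longlonglongrightarrow> 0)"

text \<open>
  The supremum is real-valued; for a basis of a Banach space the family of norms is bounded
  by the uniform boundedness principle. The extra index \<open>m = 0\<close> contributes only the value 0.
\<close>

definition basis_constant ::
    "(nat \<Rightarrow> 'a::real_normed_vector) \<Rightarrow> (nat \<Rightarrow> 'a \<Rightarrow>\<^sub>L real) \<Rightarrow> real" where
  "basis_constant e es = (SUP m. onorm (partial_sum_proj e es m))"

definition monotone_basis ::
    "(nat \<Rightarrow> 'a::real_normed_vector) \<Rightarrow> (nat \<Rightarrow> 'a \<Rightarrow>\<^sub>L real) \<Rightarrow> bool" where
  "monotone_basis e es \<longleftrightarrow> basis_constant e es = 1"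

definition indicator_vec :: "(nat \<Rightarrow> 'a::real_normed_vector) \<Rightarrow> nat set \<Rightarrow> 'a" where
  "indicator_vec e A = (\<Sum>n\<in>A. e n)"

definition signed_indicator_vec ::
    "(nat \<Rightarrow> 'a::real_normed_vector) \<Rightarrow> (nat \<Rightarrow> real) \<Rightarrow> nat set \<Rightarrow> 'a" where
  "signed_indicator_vec e \<epsilon> A = (\<Sum>n\<in>A. \<epsilon> n *\<^sub>R e n)"

text \<open>
  All infima below are of nonempty sets of nonnegative reals, and the suprema are of sets
  bounded by \<open>m * b\<close> when the norms of the \<open>e n\<close> are bounded by \<open>b\<close>. Finiteness of \<open>A\<close>
  is required because the cardinality of an infinite set is 0.
\<close>

definition dist_const ::
    "(nat \<Rightarrow> 'a::real_normed_vector) \<Rightarrow> nat \<Rightarrow> 'a \<Rightarrow> real" where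
  "dist_const e m x =
     Inf {norm (x - \<alpha> *\<^sub>R indicator_vec e A) | \<alpha> A. finite A \<and> card A = m}"

definition dist_signed_const ::
    "(nat \<Rightarrow> 'a::real_normed_vector) \<Rightarrow> nat \<Rightarrow> 'a \<Rightarrow> real" where
  "dist_signed_const e m x =
     Inf {norm (x - \<alpha> *\<^sub>R signed_indicator_vec e \<epsilon> A) | \<alpha> \<epsilon> A.
            finite A \<and> card A = m \<and> (\<forall>n. \<bar>\<epsilon> n\<bar> = 1)}"

definition lower_democracy :: "(nat \<Rightarrow> 'a::real_normed_vector) \<Rightarrow> nat \<Rightarrow> real" where
  "lower_democracy e m = Inf {norm (indicator_vec e A) | A. finite A \<and> card A = m}"

definition upper_democracy :: "(nat \<Rightarrow> 'a::real_normed_vector) \<Rightarrow> nat \<Rightarrow> real" where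
  "upper_democracy e m = Sup {norm (indicator_vec e A) | A. finite A \<and> card A = m}"

definition lower_superdemocracy :: "(nat \<Rightarrow> 'a::real_normed_vector) \<Rightarrow> nat \<Rightarrow> real" where
  "lower_superdemocracy e m =
     Inf {norm (signed_indicator_vec e \<epsilon> A) | \<epsilon> A. finite A \<and> card A = m \<and> (\<forall>n. \<bar>\<epsilon> n\<bar> = 1)}"

definition upper_superdemocracy :: "(nat \<Rightarrow> 'a::real_normed_vector) \<Rightarrow> nat \<Rightarrow> real" where
  "upper_superdemocracy e m =
     Sup {norm (signed_indicator_vec e \<epsilon> A) | \<epsilon> A. finite A \<and> card A = m \<and> (\<forall>n. \<bar>\<epsilon> n\<bar> = 1)}"

definition comparable :: "(nat \<Rightarrow> real) \<Rightarrow> (nat \<Rightarrow> real) \<Rightarrow> bool" where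
  "comparable f g \<longleftrightarrow>
     (bounded (range f) \<and> bounded (range g)) \<or>
     (filterlim f at_top sequentially \<and> filterlim g at_top sequentially)"

end

theory Submission
  imports Defs
begin

text \<open>
  The unsigned and the superdemocratic assertions are the same theorem for two families of
  admissible signs: the constant sign 1, and all signs. The proof uses three properties of
  such a family: it is nonempty, its members have modulus 1, and two members can be spliced
  at any index. These are collected in the locale \<open>signed_basis\<close>. Write \<open>D m x\<close> for the
  distance from \<open>x\<close> to the multiples of admissible indicators of size \<open>m\<close>, \<open>l\<close> and \<open>u\<close> for
  the democracy functions, \<open>P N\<close> for the partial sum projections and \<open>K\<close> for a common bound
  of their norms, which the uniform boundedness principle provides. The choice \<open>\<alpha> = 0\<close> gives
  \<open>D m x \<le> \<parallel>x\<parallel>\<close>, so only lower bounds for the lower limit of \<open>D m x\<close> matter.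

  Suppose \<open>l\<close> diverges. An indicator of size \<open>m\<close> that approximates \<open>x\<close> no worse than 0 does
  has a coefficient with \<open>\<bar>\<alpha>\<bar> l m \<le> 2 \<parallel>x\<parallel>\<close>, so \<open>\<alpha>\<close> tends to 0. Hence it barely affects
  the first \<open>N\<close> coordinates, and applying \<open>P N\<close> to the difference gives
  \<open>K \<cdot> liminf (D m x) \<ge> \<parallel>x\<parallel>\<close> (lemma \<open>distance_of_divergent\<close>). With \<open>K = 1\<close> this is the
  assertion about monotone bases.

  Suppose \<open>u\<close> is bounded. Then all signed sums of basis vectors are bounded, and by convexity
  the norm is equivalent to the supremum of the coordinates. A large set \<open>A\<close> contains an index
  where the coordinate of \<open>x\<close> is small, so \<open>\<alpha>\<close> has to be small; but then a large coordinate of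
  \<open>x\<close> cannot be cancelled (lemma \<open>distance_of_bounded\<close>).

  Conversely, if \<open>l\<close> does not diverge, then admissible indicators of every size, supported
  arbitrarily far out, have norms below one constant \<open>C\<close> (lemma
  \<open>bounded_indicators_far_out\<close>). Appending such a set to a given \<open>A\<close> shows that the indicator
  of \<open>A\<close> has distance at most \<open>C\<close> from the indicators of every large size. A lower
  estimate \<open>c \<parallel>x\<parallel>\<close> for these distances therefore bounds all indicators, and \<open>u\<close> is bounded.
\<close>

section \<open>Uniform boundedness and convexity\<close>

text \<open>
  Pointwise boundedness writes the space as a countable union of closed sets on which the
  family is uniformly bounded. By Baire's theorem one of them contains a ball, and translating
  this ball to the origin gives a bound for the operator norms.
\<close>

lemma uniform_boundedness_principle:
  fixes T :: "'i \<Rightarrow> 'a::banach \<Rightarrow> 'b::real_normed_vector"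
  assumes lin: "\<And>i. bounded_linear (T i)"
    and pointwise: "\<And>x. bounded (range (\<lambda>i. T i x))"
  obtains K where "\<And>i x. norm (T i x) \<le> K * norm x"
proof -
  define F where "F k = {x. \<forall>i. norm (T i x) \<le> real k}" for k
  have closed_F: "closed (F k)" for k
  proof -
    have "F k = (\<Inter>i. {x. norm (T i x) \<le> real k})"
      by (auto simp: F_def)
    moreover have "closed {x. norm (T i x) \<le> real k}" for i
      by (intro closed_Collect_le continuous_intros)
         (rule linear_continuous_on[OF lin])
    ultimately show ?thesis by auto
  qed
  have cover: "(\<Union>k. F k) = UNIV"
  proof -
    have "\<exists>k. x \<in> F k" for x
    proof -
      obtain B where B: "\<And>i. norm (T i x) \<le> B"
        using pointwise[of x] by (auto simp: bounded_iff)
      obtain k :: nat where "B \<le> real k"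
        using real_arch_simple by blast
      then show ?thesis
        using B by (auto simp: F_def intro: order_trans)
    qed
    then show ?thesis by auto
  qed
  obtain k where k: "interior (F k) \<noteq> {}"
  proof (rule ccontr)
    assume "\<not> thesis"
    with that have "\<And>k. interior (F k) = {}" by blast
    then have "Met_TC.mtopology interior_of \<Union>(range F) = {}"
      by (intro Met_TC.metric_Baire_category_alt) (auto simp: complete_UNIV closed_F)
    then show False
      using cover by simp
  qed
  then obtain x0 r where r: "r > 0" and ball: "ball x0 r \<subseteq> F k"
    by (auto simp: mem_interior)
  have "norm (T i x) \<le> (4 * real k / r) * norm x" for i x
  proof (cases "x = 0")
    case True
    then show ?thesis
      using linear_simps(3)[OF lin] by simp
  next
    case False
    interpret bounded_linear "T i" by (rule lin)
    define s where "s = r / (2 * norm x)"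
    have s: "s > 0" using False r by (simp add: s_def)
    have "norm (s *\<^sub>R x) = r / 2"
      using False r by (simp add: s_def)
    then have "x0 + s *\<^sub>R x \<in> ball x0 r"
      using r by (simp add: dist_norm)
    then have 1: "norm (T i (x0 + s *\<^sub>R x)) \<le> real k"
      using ball by (auto simp: F_def)
    have 2: "norm (T i x0) \<le> real k"
      using subsetD[OF ball, of x0] r by (simp add: F_def)
    have "s * norm (T i x) = norm (T i (x0 + s *\<^sub>R x) - T i x0)"
      using s by (simp add: add scaleR)
    also have "\<dots> \<le> 2 * real k"
      using norm_triangle_ineq4[of "T i (x0 + s *\<^sub>R x)" "T i x0"] 1 2 by linarith
    finally show ?thesis
      using r False by (simp add: s_def field_simps)
  qed
  then show ?thesis by (rule that)
qed

text \<open>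
  The norm is convex in each coefficient separately, hence over the cube of coefficient
  vectors it is largest at a vertex. The summand \<open>z\<close> carries the coefficients that the
  induction has already fixed.
\<close>

lemma norm_sum_le_at_cube_vertex:
  fixes y :: "'i \<Rightarrow> 'a::real_normed_vector"
  assumes "finite B" and "\<And>n. n \<in> B \<Longrightarrow> \<bar>a n\<bar> \<le> t"
    and "\<And>\<eta>. (\<forall>n. \<bar>\<eta> n\<bar> = (1::real)) \<Longrightarrow> norm (z + t *\<^sub>R (\<Sum>n\<in>B. \<eta> n *\<^sub>R y n)) \<le> C"
  shows "norm (z + (\<Sum>n\<in>B. a n *\<^sub>R y n)) \<le> C"
  using assms
proof (induction B arbitrary: z rule: finite_induct)
  case empty
  from empty.prems(2)[of "\<lambda>_. 1"] show ?case by simp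
next
  case (insert k B)
  have "norm ((z + a k *\<^sub>R y k) + t *\<^sub>R (\<Sum>n\<in>B. \<eta> n *\<^sub>R y n)) \<le> C"
    if \<eta>: "\<forall>n. \<bar>\<eta> n\<bar> = (1::real)" for \<eta>
  proof -
    define w where "w = z + t *\<^sub>R (\<Sum>n\<in>B. \<eta> n *\<^sub>R y n)"
    have vertex: "norm (w + (t * \<sigma>) *\<^sub>R y k) \<le> C" if "\<bar>\<sigma>\<bar> = 1" for \<sigma>
    proof -
      have "(\<Sum>n\<in>B. (\<eta>(k := \<sigma>)) n *\<^sub>R y n) = (\<Sum>n\<in>B. \<eta> n *\<^sub>R y n)"
        using insert.hyps by (intro sum.cong) auto
      then have "w + (t * \<sigma>) *\<^sub>R y k = z + t *\<^sub>R (\<Sum>n\<in>insert k B. (\<eta>(k := \<sigma>)) n *\<^sub>R y n)"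
        using insert.hyps by (simp add: w_def scaleR_add_right)
      then show ?thesis
        using insert.prems(2)[of "\<eta>(k := \<sigma>)"] \<eta> that by simp
    qed
    have at: "\<bar>a k\<bar> \<le> t" using insert.prems(1) by simp
    have "norm (w + a k *\<^sub>R y k) \<le> C"
    proof (cases "t = 0")
      case True
      then show ?thesis using at vertex[of 1] by simp
    next
      case False
      then have t: "t > 0" using at by linarith
      define p where "p = (1 + a k / t) / 2"
      have p: "0 \<le> p" "p \<le> 1"
        using at t by (auto simp: p_def field_simps)
      have "w + a k *\<^sub>R y k = p *\<^sub>R (w + t *\<^sub>R y k) + (1 - p) *\<^sub>R (w + (- t) *\<^sub>R y k)"
      proof -
        have "p * t + (1 - p) * (- t) = a k"
          using t by (simp add: p_def field_simps)
        moreover have "p *\<^sub>R (w + t *\<^sub>R y k) + (1 - p) *\<^sub>R (w + (- t) *\<^sub>R y k)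
            = (p + (1 - p)) *\<^sub>R w + (p * t + (1 - p) * (- t)) *\<^sub>R y k"
          by (simp only: scaleR_add_right scaleR_add_left scaleR_scaleR ac_simps)
        ultimately show ?thesis by simp
      qed
      also have "norm \<dots> \<le> p * norm (w + t *\<^sub>R y k) + (1 - p) * norm (w + (- t) *\<^sub>R y k)"
        using p norm_triangle_ineq[of "p *\<^sub>R (w + t *\<^sub>R y k)" "(1 - p) *\<^sub>R (w + (- t) *\<^sub>R y k)"]
        by simp
      also have "\<dots> \<le> p * C + (1 - p) * C"
        using p vertex[of 1] vertex[of "- 1"] by (intro add_mono mult_left_mono) auto
      also have "\<dots> = C" by (simp add: algebra_simps)
      finally show ?thesis .
    qed
    then show ?thesis by (simp add: w_def algebra_simps)
  qed
  then have "norm ((z + a k *\<^sub>R y k) + (\<Sum>n\<in>B. a n *\<^sub>R y n)) \<le> C"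
    using insert.prems(1) by (intro insert.IH) auto
  then show ?case using insert.hyps by (simp add: algebra_simps)
qed

lemma ex_initial_segment_of_card:
  fixes A :: "nat set"
  assumes "finite A" "n \<le> card A"
  shows "\<exists>N. card (A \<inter> {..<N}) = n"
  using assms(2)
proof (induction n)
  case 0
  show ?case by (intro exI[of _ 0]) simp
next
  case (Suc n)
  then obtain N where N: "card (A \<inter> {..<N}) = n" by auto
  define j where "j = Min (A - {..<N})"
  have "A - {..<N} \<noteq> {}"
  proof
    assume "A - {..<N} = {}"
    then have "A \<inter> {..<N} = A" by blast
    then show False using N Suc.prems by simp
  qed
  then have "j \<in> A - {..<N}"
    using assms(1) unfolding j_def by (intro Min_in) auto
  then have j: "j \<in> A" "N \<le> j" by auto
  have least: "j \<le> i" if "i \<in> A" "N \<le> i" for i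
    unfolding j_def using assms(1) that by (intro Min_le) auto
  have "i < Suc j \<longleftrightarrow> i = j \<or> i < N" if "i \<in> A" for i
    using least[OF that] j(2) by linarith
  then have "A \<inter> {..<Suc j} = insert j (A \<inter> {..<N})"
    using j(1) by auto
  then have "card (A \<inter> {..<Suc j}) = Suc n"
    using j N assms(1) by simp
  then show ?case ..
qed

section \<open>Schauder bases\<close>

locale schauder_basis =
  fixes e :: "nat \<Rightarrow> 'a::banach" and es :: "nat \<Rightarrow> 'a \<Rightarrow>\<^sub>L real"
  assumes basis: "seminormalized_schauder_basis e es"
begin

abbreviation P :: "nat \<Rightarrow> 'a \<Rightarrow> 'a" where
  "P \<equiv> partial_sum_proj e es"

lemma biorthogonal: "blinfun_apply (es k) (e n) = (if k = n then 1 else 0)"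
  using basis by (simp add: seminormalized_schauder_basis_def)

lemma partial_sums_tendsto: "(\<lambda>m. P m x) \<longlonglongrightarrow> x"
  using basis by (simp add: seminormalized_schauder_basis_def LIM_zero_iff tendsto_norm_zero_iff)

lemma seminormalized:
  obtains a b where "0 < a" "0 < b" "\<And>n. a \<le> norm (e n)" "\<And>n. norm (e n) \<le> b"
    "\<And>n. norm (es n) \<le> b"
  using basis unfolding seminormalized_schauder_basis_def by blast

lemma bounded_linear_P: "bounded_linear (P m)"
  unfolding partial_sum_proj_def
  by (intro bounded_linear_sum bounded_linear_scaleR_const blinfun.bounded_linear_right)

lemmas P_diff = linear_simps(2)[OF bounded_linear_P]
lemmas P_scaleR = linear_simps(5)[OF bounded_linear_P]

lemma P_uniformly_bounded:
  obtains K where "K \<ge> 1" "\<And>m x. norm (P m x) \<le> K * norm x"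
proof -
  have "bounded (range (\<lambda>m. P m x))" for x
    using partial_sums_tendsto by (intro convergent_imp_bounded)
  then obtain K where K: "\<And>m x. norm (P m x) \<le> K * norm x"
    using uniform_boundedness_principle[of P] bounded_linear_P by blast
  have "norm (P m x) \<le> max 1 K * norm x" for m x
    using K[of m x] mult_right_mono[of K "max 1 K" "norm x"] by simp
  then show ?thesis by (intro that[of "max 1 K"]) auto
qed

text \<open>
  The supremum that defines the basis constant bounds its members only because the projections
  are uniformly bounded.
\<close>

lemma monotone_basis_contractive:
  assumes "monotone_basis e es"
  shows "norm (P m x) \<le> norm x"
proof -
  obtain K where K1: "K \<ge> 1" and K: "\<And>m x. norm (P m x) \<le> K * norm x"
    using P_uniformly_bounded by metis
  then have "bdd_above (range (\<lambda>m. onorm (P m)))"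
    by (intro bdd_aboveI[of _ K]) (use K order_trans[OF zero_le_one K1] in \<open>auto intro!: onorm_bound\<close>)
  then have "onorm (P m) \<le> basis_constant e es"
    unfolding basis_constant_def by (intro cSUP_upper) auto
  then have "onorm (P m) \<le> 1"
    using assms by (simp add: monotone_basis_def)
  then show ?thesis
    using onorm[OF bounded_linear_P, of m x] mult_right_mono[of "onorm (P m)" 1 "norm x"] by simp
qed

text \<open>
  Consecutive partial sums differ by one term of the expansion, and the basis vectors are
  bounded away from zero.
\<close>

lemma coordinates_tendsto_zero: "(\<lambda>n. blinfun_apply (es n) x) \<longlonglongrightarrow> 0"
proof -
  obtain a where a: "0 < a" "\<And>n. a \<le> norm (e n)"
    using seminormalized by metis
  have "(\<lambda>n. P (Suc n) x - P n x) \<longlonglongrightarrow> x - x"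
    by (intro tendsto_diff partial_sums_tendsto LIMSEQ_Suc)
  then have lim: "(\<lambda>n. norm (P (Suc n) x - P n x) / a) \<longlonglongrightarrow> 0"
    by (intro tendsto_divide_zero tendsto_norm_zero) simp
  have le: "norm (blinfun_apply (es n) x) \<le> norm (P (Suc n) x - P n x) / a" for n
    using a mult_left_mono[OF a(2), of "\<bar>blinfun_apply (es n) x\<bar>"]
    by (simp add: partial_sum_proj_def field_simps)
  show ?thesis
    by (rule Lim_null_comparison[OF _ lim]) (simp only: le eventually_True)
qed

lemma coordinate_signed_indicator:
  assumes "finite A"
  shows "blinfun_apply (es k) (signed_indicator_vec e \<epsilon> A) = (if k \<in> A then \<epsilon> k else 0)"
  using assms
  by (simp add: signed_indicator_vec_def blinfun.sum_right blinfun.scaleR_right biorthogonal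
      if_distrib cong: if_cong)

lemma P_signed_indicator:
  assumes "finite A"
  shows "P N (signed_indicator_vec e \<epsilon> A) = signed_indicator_vec e \<epsilon> (A \<inter> {..<N})"
proof -
  have "P N (signed_indicator_vec e \<epsilon> A) = (\<Sum>n<N. if n \<in> A then \<epsilon> n *\<^sub>R e n else 0)"
    unfolding partial_sum_proj_def
    by (intro sum.cong) (auto simp: coordinate_signed_indicator[OF assms])
  also have "\<dots> = (\<Sum>n\<in>{..<N} \<inter> A. \<epsilon> n *\<^sub>R e n)"
    by (simp add: sum.inter_restrict)
  finally show ?thesis
    by (simp add: signed_indicator_vec_def Int_commute)
qed

end

section \<open>Distances and democracy functions for a family of signs\<close>

definition family_dist ::
    "(nat \<Rightarrow> 'a::real_normed_vector) \<Rightarrow> (nat \<Rightarrow> real) set \<Rightarrow> nat \<Rightarrow> 'a \<Rightarrow> real" where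
  "family_dist e S m x =
     Inf {norm (x - \<alpha> *\<^sub>R signed_indicator_vec e \<epsilon> A) | \<alpha> \<epsilon> A. finite A \<and> card A = m \<and> \<epsilon> \<in> S}"

definition family_lower ::
    "(nat \<Rightarrow> 'a::real_normed_vector) \<Rightarrow> (nat \<Rightarrow> real) set \<Rightarrow> nat \<Rightarrow> real" where
  "family_lower e S m =
     Inf {norm (signed_indicator_vec e \<epsilon> A) | \<epsilon> A. finite A \<and> card A = m \<and> \<epsilon> \<in> S}"

definition family_upper ::
    "(nat \<Rightarrow> 'a::real_normed_vector) \<Rightarrow> (nat \<Rightarrow> real) set \<Rightarrow> nat \<Rightarrow> real" where
  "family_upper e S m =
     Sup {norm (signed_indicator_vec e \<epsilon> A) | \<epsilon> A. finite A \<and> card A = m \<and> \<epsilon> \<in> S}"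

text \<open>
  The splicing condition is the only way in which signs on different parts of a set have to
  fit together: it lets an indicator be continued by another one further out. Both the
  constant sign 1 alone and the family of all signs satisfy it.
\<close>

locale signed_basis = schauder_basis e es
  for e :: "nat \<Rightarrow> 'a::banach" and es :: "nat \<Rightarrow> 'a \<Rightarrow>\<^sub>L real" +
  fixes S :: "(nat \<Rightarrow> real) set"
  assumes nonempty: "S \<noteq> {}"
    and unimodular: "\<epsilon> \<in> S \<Longrightarrow> \<bar>\<epsilon> n\<bar> = 1"
    and splice: "\<epsilon> \<in> S \<Longrightarrow> \<eta> \<in> S \<Longrightarrow> (\<lambda>n. if n < N then \<epsilon> n else \<eta> n) \<in> S"
begin

abbreviation I :: "(nat \<Rightarrow> real) \<Rightarrow> nat set \<Rightarrow> 'a" where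
  "I \<equiv> signed_indicator_vec e"

abbreviation D :: "nat \<Rightarrow> 'a \<Rightarrow> real" where
  "D \<equiv> family_dist e S"

abbreviation l :: "nat \<Rightarrow> real" where
  "l \<equiv> family_lower e S"

abbreviation u :: "nat \<Rightarrow> real" where
  "u \<equiv> family_upper e S"

lemma ex_indicator: "\<exists>\<epsilon> (A :: nat set). finite A \<and> card A = m \<and> \<epsilon> \<in> S"
  using nonempty card_lessThan[of m] finite_lessThan[of m] by blast

lemma norm_indicator_le:
  assumes "\<epsilon> \<in> S" "\<And>n. norm (e n) \<le> b"
  shows "norm (I \<epsilon> A) \<le> real (card A) * b"
  unfolding signed_indicator_vec_def
  using assms by (intro sum_norm_bound) (auto simp: unimodular)

lemma D_le:
  assumes "finite A" "card A = m" "\<epsilon> \<in> S"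
  shows "D m x \<le> norm (x - \<alpha> *\<^sub>R I \<epsilon> A)"
  unfolding family_dist_def
  using assms by (intro cInf_lower bdd_belowI[of _ 0]) auto

lemma D_greatest:
  assumes "\<And>\<alpha> \<epsilon> A. finite A \<Longrightarrow> card A = m \<Longrightarrow> \<epsilon> \<in> S \<Longrightarrow> d \<le> norm (x - \<alpha> *\<^sub>R I \<epsilon> A)"
  shows "d \<le> D m x"
  unfolding family_dist_def
  using assms ex_indicator[of m] by (intro cInf_greatest) blast+

lemma D_le_norm: "D m x \<le> norm x"
  using ex_indicator[of m] D_le[where x = x and \<alpha> = 0] by auto

lemma l_le:
  assumes "finite A" "card A = m" "\<epsilon> \<in> S"
  shows "l m \<le> norm (I \<epsilon> A)"
  unfolding family_lower_def
  using assms by (intro cInf_lower bdd_belowI[of _ 0]) auto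

lemma l_less_witness:
  assumes "l m < C"
  obtains \<epsilon> A where "finite A" "card A = m" "\<epsilon> \<in> S" "norm (I \<epsilon> A) < C"
proof -
  have "{norm (I \<epsilon> A) |\<epsilon> A. finite A \<and> card A = m \<and> \<epsilon> \<in> S} \<noteq> {}"
    using ex_indicator[of m] by blast
  from cInf_lessD[OF this assms[unfolded family_lower_def]] that show ?thesis by blast
qed

lemma le_u:
  assumes "finite A" "card A = m" "\<epsilon> \<in> S"
  shows "norm (I \<epsilon> A) \<le> u m"
proof -
  obtain b where "\<And>n. norm (e n) \<le> b"
    using seminormalized by metis
  then have "norm (I \<eta> B) \<le> real m * b" if "card B = m" "\<eta> \<in> S" for \<eta> B
    using norm_indicator_le[OF that(2)] that(1) by blast
  then show ?thesis
    unfolding family_upper_def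
    using assms by (intro cSup_upper bdd_aboveI[of _ "real m * b"]) blast+
qed

lemma u_least:
  assumes "\<And>\<epsilon> A. finite A \<Longrightarrow> card A = m \<Longrightarrow> \<epsilon> \<in> S \<Longrightarrow> norm (I \<epsilon> A) \<le> C"
  shows "u m \<le> C"
  unfolding family_upper_def
  using assms ex_indicator[of m] by (intro cSup_least) blast+

lemma l_nonneg: "0 \<le> l m"
  unfolding family_lower_def using ex_indicator[of m] by (intro cInf_greatest) auto

lemma l_le_u: "l m \<le> u m"
  using ex_indicator[of m] l_le le_u order_trans by blast

section \<open>Divergent lower democracy function\<close>

text \<open>
  Only indicators at distance at most \<open>\<parallel>x\<parallel>\<close> from \<open>x\<close> compete, and for them
  \<open>\<bar>\<alpha>\<bar> l m \<le> 2 \<parallel>x\<parallel>\<close>. So the coefficients of the competitors tend to 0 uniformly, and on the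
  first \<open>N\<close> coordinates every competitor is close to 0.
\<close>

lemma distance_of_divergent:
  assumes l: "filterlim l at_top sequentially"
    and K: "K \<ge> 1" "\<And>m x. norm (P m x) \<le> K * norm x"
    and \<delta>: "\<delta> > 0"
  shows "\<forall>\<^sub>F m in sequentially. norm x / K - \<delta> \<le> D m x"
proof -
  obtain b where b: "b > 0" "\<And>n. norm (e n) \<le> b"
    using seminormalized by metis
  have K\<delta>: "K * \<delta> / 2 > 0" using K \<delta> by simp
  then obtain N where N: "norm (P N x - x) < K * \<delta> / 2"
    using LIMSEQ_D[OF partial_sums_tendsto, of "K * \<delta> / 2" x] by blast
  \<comment> \<open>Chosen so that \<open>\<bar>\<alpha>\<bar> H \<le> 2 \<parallel>x\<parallel>\<close> implies \<open>\<bar>\<alpha>\<bar> N b \<le> K \<delta> / 2\<close>;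
    the summand 1 makes it positive.\<close>
  define H where "H = 2 * norm x * real N * b / (K * \<delta> / 2) + 1"
  have "2 * norm x * real N * b / (K * \<delta> / 2) \<ge> 0"
    using b K\<delta> by (intro divide_nonneg_pos mult_nonneg_nonneg) auto
  then have H: "H > 0" by (simp add: H_def)
  have HN: "2 * norm x * (real N * b) \<le> K * \<delta> / 2 * H"
    unfolding H_def using K \<delta> by (simp add: field_simps)
  have "norm x / K - \<delta> \<le> norm (x - \<alpha> *\<^sub>R I \<epsilon> A)"
    if lm: "l m \<ge> H" and A: "finite A" "card A = m" and \<epsilon>: "\<epsilon> \<in> S" for m \<alpha> \<epsilon> A
  proof (cases "norm (x - \<alpha> *\<^sub>R I \<epsilon> A) \<le> norm x")
    case False
    have "norm x / K \<le> norm x"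
      using K(1) mult_left_mono[OF K(1), of "norm x"] by (simp add: field_simps)
    then show ?thesis using False \<delta> by linarith
  next
    case True
    have "\<bar>\<alpha>\<bar> * H \<le> \<bar>\<alpha>\<bar> * norm (I \<epsilon> A)"
      using lm l_le[OF A \<epsilon>] by (intro mult_left_mono) auto
    also have "\<dots> = norm (x - (x - \<alpha> *\<^sub>R I \<epsilon> A))" by simp
    also have "\<dots> \<le> 2 * norm x"
      using norm_triangle_ineq4[of x "x - \<alpha> *\<^sub>R I \<epsilon> A"] True by linarith
    finally have "\<bar>\<alpha>\<bar> * H * (real N * b) \<le> 2 * norm x * (real N * b)"
      using b by (intro mult_right_mono) auto
    with HN have "(\<bar>\<alpha>\<bar> * (real N * b)) * H \<le> K * \<delta> / 2 * H"
      by (simp add: mult_ac)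
    then have \<alpha>N: "\<bar>\<alpha>\<bar> * (real N * b) \<le> K * \<delta> / 2"
      using H by simp
    have "card (A \<inter> {..<N}) \<le> N"
      using card_mono[of "{..<N}" "A \<inter> {..<N}"] by simp
    then have "real (card (A \<inter> {..<N})) * b \<le> real N * b"
      using b by (intro mult_right_mono) auto
    then have "norm (I \<epsilon> (A \<inter> {..<N})) \<le> real N * b"
      using norm_indicator_le[OF \<epsilon> b(2), of "A \<inter> {..<N}"] by linarith
    then have small: "norm (\<alpha> *\<^sub>R I \<epsilon> (A \<inter> {..<N})) \<le> K * \<delta> / 2"
      using mult_left_mono[of _ "real N * b" "\<bar>\<alpha>\<bar>"] \<alpha>N by fastforce
    have "norm (P N x) - norm (\<alpha> *\<^sub>R I \<epsilon> (A \<inter> {..<N})) \<le> norm (P N (x - \<alpha> *\<^sub>R I \<epsilon> A))"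
      by (simp only: P_diff P_scaleR P_signed_indicator[OF A(1)] norm_triangle_ineq2)
    moreover have "norm x - norm (P N x) \<le> K * \<delta> / 2"
      using norm_triangle_ineq2[of x "P N x"] N by (simp add: norm_minus_commute)
    ultimately have "norm x - K * \<delta> \<le> K * norm (x - \<alpha> *\<^sub>R I \<epsilon> A)"
      using K(2)[of N "x - \<alpha> *\<^sub>R I \<epsilon> A"] small by linarith
    then show ?thesis using K(1) by (simp add: field_simps)
  qed
  then have "norm x / K - \<delta> \<le> D m x" if "l m \<ge> H" for m
    using that by (intro D_greatest) auto
  moreover have "\<forall>\<^sub>F m in sequentially. l m \<ge> H"
    using l by (simp add: filterlim_at_top)
  ultimately show ?thesis
    by (auto elim: eventually_mono)
qed

section \<open>Bounded upper democracy function\<close>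

text \<open>
  An arbitrary signed sum of basis vectors splits into the part where its signs agree with a
  fixed admissible \<open>\<epsilon>\<close> and the part where they are opposite, so it is a difference of two
  admissible indicators. Bounded admissible indicators thus make the basis equivalent to the
  unit vector basis of \<open>c\<^sub>0\<close>.
\<close>

lemma norm_le_sup_coordinates:
  assumes U: "\<And>m. u m \<le> U"
    and t: "\<And>n. \<bar>blinfun_apply (es n) x\<bar> \<le> t"
  shows "norm x \<le> 2 * U * t"
proof -
  obtain \<epsilon> where \<epsilon>: "\<epsilon> \<in> S" using nonempty by blast
  have "t \<ge> 0" using t[of 0] by linarith
  have signs: "norm (\<Sum>n\<in>B. \<eta> n *\<^sub>R e n) \<le> 2 * U"
    if B: "finite B" and \<eta>: "\<forall>n. \<bar>\<eta> n\<bar> = (1::real)" for B \<eta>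
  proof -
    define agree where "agree = {n \<in> B. \<eta> n = \<epsilon> n}"
    have "B = agree \<union> (B - agree)" by (auto simp: agree_def)
    then have "(\<Sum>n\<in>B. \<eta> n *\<^sub>R e n) = (\<Sum>n\<in>agree. \<eta> n *\<^sub>R e n) + (\<Sum>n\<in>B - agree. \<eta> n *\<^sub>R e n)"
      using B by (metis (no_types, lifting) Diff_disjoint finite_Un sum.union_disjoint)
    also have "(\<Sum>n\<in>agree. \<eta> n *\<^sub>R e n) = I \<epsilon> agree"
      unfolding signed_indicator_vec_def by (intro sum.cong) (auto simp: agree_def)
    also have "(\<Sum>n\<in>B - agree. \<eta> n *\<^sub>R e n) = - I \<epsilon> (B - agree)"
    proof -
      have "\<eta> n = - \<epsilon> n" if "n \<in> B - agree" for n
        using that \<eta>[rule_format, of n] unimodular[OF \<epsilon>, of n]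
        by (auto simp: agree_def abs_if split: if_splits)
      then show ?thesis
        by (simp add: signed_indicator_vec_def sum_negf)
    qed
    also have "norm (I \<epsilon> agree + - I \<epsilon> (B - agree)) \<le> norm (I \<epsilon> agree) + norm (I \<epsilon> (B - agree))"
      using norm_triangle_ineq4[of "I \<epsilon> agree" "I \<epsilon> (B - agree)"] by simp
    also have "\<dots> \<le> U + U"
      using B \<epsilon> by (intro add_mono order_trans[OF le_u U]) (auto simp: agree_def)
    finally show ?thesis by simp
  qed
  have "norm (P m x) \<le> 2 * U * t" for m
  proof -
    have "norm (0 + (\<Sum>n<m. blinfun_apply (es n) x *\<^sub>R e n)) \<le> 2 * U * t"
    proof (rule norm_sum_le_at_cube_vertex[where t = t])
      fix \<eta> :: "nat \<Rightarrow> real"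
      assume "\<forall>n. \<bar>\<eta> n\<bar> = 1"
      then have "t * norm (\<Sum>n<m. \<eta> n *\<^sub>R e n) \<le> t * (2 * U)"
        using \<open>t \<ge> 0\<close> by (intro mult_left_mono signs) auto
      then show "norm (0 + t *\<^sub>R (\<Sum>n<m. \<eta> n *\<^sub>R e n)) \<le> 2 * U * t"
        using \<open>t \<ge> 0\<close> by (simp add: mult_ac)
    qed (use t in auto)
    then show ?thesis by (simp add: partial_sum_proj_def)
  qed
  then show ?thesis
    by (intro LIMSEQ_le_const2[OF tendsto_norm[OF partial_sums_tendsto]]) auto
qed

text \<open>
  Let \<open>t\<close> be less than some coordinate of \<open>x\<close>, in modulus, say the one at \<open>k\<close>. A set with more
  than \<open>N\<close> elements contains an index \<open>n \<ge> N\<close>, where the coordinate of \<open>x\<close> is at most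
  \<open>t / 2\<close>. If \<open>k \<in> A\<close>, then subtracting \<open>\<alpha>\<close> times the indicator of \<open>A\<close> leaves at least
  \<open>t - \<bar>\<alpha>\<bar>\<close> at \<open>k\<close> and at least \<open>\<bar>\<alpha>\<bar> - t / 2\<close> at \<open>n\<close>, and one of these is at least \<open>t / 4\<close>.
\<close>

lemma distance_of_bounded:
  assumes U: "\<And>m. u m \<le> U"
  shows "\<exists>c>0. \<forall>x. \<forall>\<^sub>F m in sequentially. c * norm x \<le> D m x"
proof -
  obtain b where b: "b > 0" "\<And>n. norm (es n) \<le> b"
    using seminormalized by metis
  define M where "M = max 1 (2 * U)"
  have M: "M > 0" by (simp add: M_def)
  have sup: "norm x \<le> M * t" if "\<And>n. \<bar>blinfun_apply (es n) x\<bar> \<le> t" for x t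
  proof -
    have "t \<ge> 0" using that[of 0] by linarith
    then have "2 * U * t \<le> M * t" by (intro mult_right_mono) (auto simp: M_def)
    then show ?thesis using norm_le_sup_coordinates[OF U that] by linarith
  qed
  have "\<forall>\<^sub>F m in sequentially. 1 / (8 * M * b) * norm x \<le> D m x" for x
  proof (cases "x = 0")
    case True
    have "0 \<le> D m x" for m by (intro D_greatest) auto
    then show ?thesis using True by simp
  next
    case False
    define t where "t = norm x / (2 * M)"
    have t: "t > 0" using False M by (simp add: t_def)
    have "M * t < norm x" using False M by (simp add: t_def)
    then obtain k where k: "\<bar>blinfun_apply (es k) x\<bar> > t"
      using sup[of x t] by (meson not_le)
    obtain N where N: "\<And>n. n \<ge> N \<Longrightarrow> \<bar>blinfun_apply (es n) x\<bar> < t / 2"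
      using LIMSEQ_D[OF coordinates_tendsto_zero, of "t / 2" x] t by auto
    have "t / (4 * b) \<le> norm (x - \<alpha> *\<^sub>R I \<epsilon> A)"
      if A: "finite A" "card A > N" and \<epsilon>: "\<epsilon> \<in> S" for \<alpha> \<epsilon> A
    proof -
      define d where "d = norm (x - \<alpha> *\<^sub>R I \<epsilon> A)"
      have coord: "\<bar>blinfun_apply (es n) x - \<alpha> * (if n \<in> A then \<epsilon> n else 0)\<bar> \<le> b * d" for n
      proof -
        have "\<bar>blinfun_apply (es n) (x - \<alpha> *\<^sub>R I \<epsilon> A)\<bar> \<le> norm (es n) * d"
          using norm_blinfun[of "es n" "x - \<alpha> *\<^sub>R I \<epsilon> A"] by (simp add: d_def)
        also have "\<dots> \<le> b * d"
          using b by (intro mult_right_mono) (auto simp: d_def)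
        finally show ?thesis
          by (simp only: blinfun.diff_right blinfun.scaleR_right
              coordinate_signed_indicator[OF A(1)] real_scaleR_def)
      qed
      obtain n where n: "n \<in> A" "n \<ge> N"
        using A card_mono[of "{..<N}" A] by (force simp: not_le)
      have "\<bar>\<alpha> * \<epsilon> j\<bar> = \<bar>\<alpha>\<bar>" for j
        using unimodular[OF \<epsilon>] by (simp add: abs_mult)
      note \<alpha> = this[of n] this[of k]
      have "\<bar>\<alpha>\<bar> - t / 2 \<le> b * d"
        using coord[of n] n N[of n] \<alpha> by simp
      moreover have "t - \<bar>\<alpha>\<bar> \<le> b * d" if "k \<in> A"
        using coord[of k] that k \<alpha> by simp
      moreover have "t \<le> b * d" if "k \<notin> A"
        using coord[of k] that k by simp
      ultimately have "t / 4 \<le> b * d" using t by (cases "k \<in> A") auto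
      then show ?thesis using b by (simp add: d_def field_simps)
    qed
    then have "t / (4 * b) \<le> D m x" if "m > N" for m
      using that by (intro D_greatest) auto
    moreover have "t / (4 * b) = 1 / (8 * M * b) * norm x"
      by (simp add: t_def)
    ultimately show ?thesis
      by (intro eventually_mono[OF eventually_gt_at_top[of N]]) simp
  qed
  moreover have "1 / (8 * M * b) > 0" using M b by simp
  ultimately show ?thesis by blast
qed

section \<open>Consequences of a lower estimate for the distances\<close>

text \<open>
  Some \<open>C\<close> exceeds \<open>l m\<close> for arbitrarily large \<open>m\<close>. A set \<open>A\<close> of at least \<open>N + n\<close> elements
  with indicator of norm below \<open>C\<close> has a piece of \<open>n\<close> elements between \<open>N\<close> and some \<open>N'\<close>, and
  the indicator of this piece is the image of that of \<open>A\<close> under \<open>P N' \<circ> (id - P N)\<close>.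
\<close>

lemma bounded_indicators_far_out:
  assumes "\<not> filterlim l at_top sequentially"
  obtains C where "\<And>N n. \<exists>\<epsilon> B. finite B \<and> card B = n \<and> B \<subseteq> {N..} \<and> \<epsilon> \<in> S \<and> norm (I \<epsilon> B) \<le> C"
proof -
  obtain K where K: "K \<ge> 1" "\<And>m x. norm (P m x) \<le> K * norm x"
    using P_uniformly_bounded by metis
  obtain C where "\<not> (\<forall>\<^sub>F m in sequentially. C \<le> l m)"
    using assms by (auto simp: filterlim_at_top)
  then have C: "\<exists>m\<ge>n. l m < C" for n
    by (auto simp: eventually_sequentially not_le)
  have "\<exists>\<epsilon> B. finite B \<and> card B = n \<and> B \<subseteq> {N..} \<and> \<epsilon> \<in> S \<and> norm (I \<epsilon> B) \<le> K * (C + K * C)" for N n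
  proof -
    obtain m where m: "m \<ge> N + n" "l m < C" using C by blast
    obtain \<epsilon> A where A: "finite A" "card A = m" and \<epsilon>: "\<epsilon> \<in> S" and less: "norm (I \<epsilon> A) < C"
      using l_less_witness[OF m(2)] .
    have "m - N \<le> card (A - {..<N})"
      using diff_card_le_card_Diff[of "{..<N}" A] A by simp
    then have "n \<le> card (A - {..<N})" using m by linarith
    then obtain N' where N': "card ((A - {..<N}) \<inter> {..<N'}) = n"
      using ex_initial_segment_of_card[of "A - {..<N}" n] A by auto
    define B where "B = (A - {..<N}) \<inter> {..<N'}"
    have "I \<epsilon> (A - {..<N}) = I \<epsilon> A - I \<epsilon> (A \<inter> {..<N})"
    proof -
      have "A - {..<N} = A - A \<inter> {..<N}" by blast
      then show ?thesis
        unfolding signed_indicator_vec_def using A by (simp add: sum_diff)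
    qed
    then have "I \<epsilon> B = P N' (I \<epsilon> A - P N (I \<epsilon> A))"
      using A by (simp add: B_def P_signed_indicator flip: P_signed_indicator[of "A - {..<N}"])
    then have "norm (I \<epsilon> B) \<le> K * norm (I \<epsilon> A - P N (I \<epsilon> A))"
      using K(2) by simp
    also have "\<dots> \<le> K * (C + K * C)"
    proof (rule mult_left_mono)
      have "norm (I \<epsilon> A - P N (I \<epsilon> A)) \<le> norm (I \<epsilon> A) + K * norm (I \<epsilon> A)"
        using norm_triangle_ineq4[of "I \<epsilon> A" "P N (I \<epsilon> A)"] K(2)[of N "I \<epsilon> A"] by linarith
      also have "\<dots> \<le> C + K * C"
        using less K(1) by (intro add_mono mult_left_mono) auto
      finally show "norm (I \<epsilon> A - P N (I \<epsilon> A)) \<le> C + K * C" .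
    qed (use K in simp)
    finally show ?thesis
      using N' \<epsilon> A by (intro exI[of _ \<epsilon>] exI[of _ B]) (auto simp: B_def)
  qed
  then show ?thesis by (rule that)
qed

text \<open>
  Complete \<open>A\<close> to a set of size \<open>m\<close> by indices beyond \<open>A\<close>. Splicing makes the union admissible,
  and with \<open>\<alpha> = 1\<close> only the added part remains.
\<close>

lemma distance_of_indicator_le:
  assumes C: "\<And>N n. \<exists>\<epsilon> B. finite B \<and> card B = n \<and> B \<subseteq> {N..} \<and> \<epsilon> \<in> S \<and> norm (I \<epsilon> B) \<le> C"
    and A: "finite A" and \<epsilon>: "\<epsilon> \<in> S" and m: "m \<ge> card A"
  shows "D m (I \<epsilon> A) \<le> C"
proof -
  obtain N where N: "A \<subseteq> {..<N}"
    using A by (auto simp: finite_nat_iff_bounded)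
  obtain \<eta> B where B: "finite B" "card B = m - card A" "B \<subseteq> {N..}"
    and \<eta>: "\<eta> \<in> S" and le: "norm (I \<eta> B) \<le> C"
    using C[where n = "m - card A" and N = N] by (elim exE conjE)
  define \<zeta> where "\<zeta> n = (if n < N then \<epsilon> n else \<eta> n)" for n
  have \<zeta>: "\<zeta> \<in> S" unfolding \<zeta>_def using splice[OF \<epsilon> \<eta>] .
  have disj: "A \<inter> B = {}" using N B by fastforce
  have "I \<zeta> (A \<union> B) = I \<zeta> A + I \<zeta> B"
    unfolding signed_indicator_vec_def using A B disj by (intro sum.union_disjoint)
  also have "I \<zeta> A = I \<epsilon> A"
    unfolding signed_indicator_vec_def using N by (intro sum.cong) (auto simp: \<zeta>_def)
  also have "I \<zeta> B = I \<eta> B"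
    unfolding signed_indicator_vec_def using B by (intro sum.cong) (auto simp: \<zeta>_def)
  finally have "norm (I \<epsilon> A - 1 *\<^sub>R I \<zeta> (A \<union> B)) = norm (I \<eta> B)" by simp
  moreover have "card (A \<union> B) = m"
    using A B disj m by (simp add: card_Un_disjoint)
  ultimately show ?thesis
    using D_le[of "A \<union> B" m \<zeta> "I \<epsilon> A" 1] A B \<zeta> le by simp
qed

lemma comparable_of_lower_estimate:
  assumes c: "c > 0" "\<And>x. ereal (c * norm x) \<le> limsup (\<lambda>m. ereal (D m x))"
  shows "comparable l u"
proof (cases "filterlim l at_top sequentially")
  case True
  then have "filterlim u at_top sequentially"
    by (rule filterlim_at_top_mono) (simp add: l_le_u)
  then show ?thesis using True by (simp add: comparable_def)
next
  case False
  then obtain C where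
    C: "\<And>N n. \<exists>\<epsilon> B. finite B \<and> card B = n \<and> B \<subseteq> {N..} \<and> \<epsilon> \<in> S \<and> norm (I \<epsilon> B) \<le> C"
    using bounded_indicators_far_out by blast
  have u: "u m \<le> C / c" for m
  proof (rule u_least)
    fix \<epsilon> and A :: "nat set"
    assume A: "finite A" "\<epsilon> \<in> S"
    have "\<forall>\<^sub>F m in sequentially. D m (I \<epsilon> A) \<le> C"
      using distance_of_indicator_le[OF C A] by (auto simp: eventually_sequentially)
    then have "limsup (\<lambda>m. ereal (D m (I \<epsilon> A))) \<le> ereal C"
      by (intro Limsup_bounded) simp
    then have "ereal (c * norm (I \<epsilon> A)) \<le> ereal C"
      using c(2) order_trans by blast
    then show "norm (I \<epsilon> A) \<le> C / c"
      using c(1) by (simp add: field_simps)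
  qed
  have "\<bar>l m\<bar> \<le> C / c" "\<bar>u m\<bar> \<le> C / c" for m
    using l_nonneg[of m] l_le_u[of m] u[of m] by linarith+
  then show ?thesis
    unfolding comparable_def bounded_iff by auto
qed

section \<open>The equivalence for a family of signs\<close>

lemma lower_estimate_of_comparable:
  assumes "comparable l u"
  shows "\<exists>c>0. \<forall>x. ereal (c * norm x) \<le> liminf (\<lambda>m. ereal (D m x))"
  using assms unfolding comparable_def
proof (elim disjE conjE)
  assume "bounded (range u)"
  then obtain U where U: "\<And>m. u m \<le> U"
    by (auto simp: bounded_iff abs_le_iff)
  obtain c where c: "c > 0" "\<forall>x. \<forall>\<^sub>F m in sequentially. c * norm x \<le> D m x"
    using distance_of_bounded[OF U] by (elim exE conjE)
  have "ereal (c * norm x) \<le> liminf (\<lambda>m. ereal (D m x))" for x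
    by (rule Liminf_bounded) (simp add: c(2))
  then show ?thesis
    using c(1) by (intro exI[of _ c]) simp
next
  assume l: "filterlim l at_top sequentially"
  obtain K where K: "K \<ge> 1" "\<And>m x. norm (P m x) \<le> K * norm x"
    using P_uniformly_bounded by metis
  have "ereal (norm x / K) \<le> liminf (\<lambda>m. ereal (D m x))" for x
  proof (rule ereal_le_epsilon2)
    fix \<delta> :: real
    assume "\<delta> > 0"
    then have "\<forall>\<^sub>F m in sequentially. ereal (norm x / K - \<delta>) \<le> ereal (D m x)"
      using distance_of_divergent[OF l K] by simp
    then have "ereal (norm x / K - \<delta>) \<le> liminf (\<lambda>m. ereal (D m x))"
      by (rule Liminf_bounded)
    then have "ereal (norm x / K - \<delta>) + ereal \<delta> \<le> liminf (\<lambda>m. ereal (D m x)) + ereal \<delta>"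
      by (rule add_right_mono)
    then show "ereal (norm x / K) \<le> liminf (\<lambda>m. ereal (D m x)) + ereal \<delta>"
      by simp
  qed
  then show ?thesis
    using K(1) by (intro exI[of _ "1 / K"]) simp
qed

theorem estimate_iff_comparable:
  "(\<exists>c>0. \<forall>x.
      ereal (c * norm x) \<le> liminf (\<lambda>m. ereal (D m x)) \<and>
      liminf (\<lambda>m. ereal (D m x)) \<le> limsup (\<lambda>m. ereal (D m x)) \<and>
      limsup (\<lambda>m. ereal (D m x)) \<le> ereal (norm x))
    \<longleftrightarrow> comparable l u"
    (is "(\<exists>c>0. \<forall>x. ?estimate c x) \<longleftrightarrow> _")
proof -
  have between: "liminf (\<lambda>m. ereal (D m x)) \<le> limsup (\<lambda>m. ereal (D m x))"
    "limsup (\<lambda>m. ereal (D m x)) \<le> ereal (norm x)" for x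
    by (auto intro!: Liminf_le_Limsup Limsup_bounded simp: D_le_norm)
  show ?thesis
  proof
    assume "comparable l u"
    then show "\<exists>c>0. \<forall>x. ?estimate c x"
      by (simp add: lower_estimate_of_comparable between)
  next
    assume "\<exists>c>0. \<forall>x. ?estimate c x"
    then obtain c where c: "c > 0" and est: "\<forall>x. ?estimate c x" by (elim exE conjE)
    show "comparable l u"
    proof (rule comparable_of_lower_estimate[OF c])
      fix x
      show "ereal (c * norm x) \<le> limsup (\<lambda>m. ereal (D m x))"
        using est[rule_format, of x] by (elim conjE) (rule order_trans)
    qed
  qed
qed

theorem monotone_distance_tendsto_norm:
  assumes "monotone_basis e es" "filterlim l at_top sequentially"
  shows "(\<lambda>m. D m x) \<longlonglongrightarrow> norm x"
proof (rule LIMSEQ_I)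
  fix r :: real
  assume "r > 0"
  then have "\<forall>\<^sub>F m in sequentially. norm x / 1 - r / 2 \<le> D m x"
    using monotone_basis_contractive[OF assms(1)]
    by (intro distance_of_divergent assms(2)) simp_all
  then obtain M where M: "\<And>m. m \<ge> M \<Longrightarrow> norm x - r / 2 \<le> D m x"
    by (auto simp: eventually_sequentially)
  have "norm (D m x - norm x) < r" if "m \<ge> M" for m
    using M[OF that] D_le_norm[of m x] \<open>r > 0\<close> by simp
  then show "\<exists>M. \<forall>m\<ge>M. norm (D m x - norm x) < r" by blast
qed

end

section \<open>Constant signs and arbitrary signs\<close>

lemma signed_indicator_vec_one: "signed_indicator_vec e (\<lambda>_. 1) = indicator_vec e"
  by (simp add: fun_eq_iff signed_indicator_vec_def indicator_vec_def)

lemma family_all_signs: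
  fixes e :: "nat \<Rightarrow> 'a::real_normed_vector"
  defines "S \<equiv> {\<epsilon>. \<forall>n. \<bar>\<epsilon> n\<bar> = 1}"
  shows "family_dist e S = dist_signed_const e"
    and "family_lower e S = lower_superdemocracy e"
    and "family_upper e S = upper_superdemocracy e"
  by (simp_all add: fun_eq_iff S_def family_dist_def dist_signed_const_def family_lower_def
      lower_superdemocracy_def family_upper_def upper_superdemocracy_def)

lemma family_constant_sign:
  fixes e :: "nat \<Rightarrow> 'a::real_normed_vector"
  shows "family_dist e {\<lambda>_. 1} = dist_const e"
    and "family_lower e {\<lambda>_. 1} = lower_democracy e"
    and "family_upper e {\<lambda>_. 1} = upper_democracy e"
proof -
  have elim:
    "{f \<epsilon> A |\<epsilon> A. finite A \<and> card A = m \<and> \<epsilon> \<in> {\<lambda>_. 1}} = {f (\<lambda>_. 1) A |A. finite A \<and> card A = m}"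
    "{g \<alpha> \<epsilon> A |\<alpha> \<epsilon> A. finite A \<and> card A = m \<and> \<epsilon> \<in> {\<lambda>_. 1}} =
      {g \<alpha> (\<lambda>_. 1) A |\<alpha> A. finite A \<and> card A = m}"
    for f :: "(nat \<Rightarrow> real) \<Rightarrow> nat set \<Rightarrow> real"
      and g :: "real \<Rightarrow> (nat \<Rightarrow> real) \<Rightarrow> nat set \<Rightarrow> real" and m
    by blast+
  show "family_dist e {\<lambda>_. 1} = dist_const e"
    and "family_lower e {\<lambda>_. 1} = lower_democracy e"
    and "family_upper e {\<lambda>_. 1} = upper_democracy e"
    by (intro ext, simp only: family_dist_def dist_const_def family_lower_def
        lower_democracy_def family_upper_def upper_democracy_def elim signed_indicator_vec_one)+
qed

theorem theorem3p2:
  fixes e :: "nat \<Rightarrow> 'a::banach" and es :: "nat \<Rightarrow> 'a \<Rightarrow>\<^sub>L real"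
  assumes "seminormalized_schauder_basis e es"
  shows
    "((\<exists>c>0. \<forall>x.
         ereal (c * norm x) \<le> liminf (\<lambda>m. ereal (dist_signed_const e m x)) \<and>
         liminf (\<lambda>m. ereal (dist_signed_const e m x))
           \<le> limsup (\<lambda>m. ereal (dist_signed_const e m x)) \<and>
         limsup (\<lambda>m. ereal (dist_signed_const e m x)) \<le> ereal (norm x))
       \<longleftrightarrow> comparable (lower_superdemocracy e) (upper_superdemocracy e)) \<and>
     (monotone_basis e es \<and> filterlim (lower_superdemocracy e) at_top sequentially
       \<longrightarrow> (\<forall>x. (\<lambda>m. dist_signed_const e m x) \<longlonglongrightarrow> norm x)) \<and>
     ((\<exists>c>0. \<forall>x.
         ereal (c * norm x) \<le> liminf (\<lambda>m. ereal (dist_const e m x)) \<and>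
         liminf (\<lambda>m. ereal (dist_const e m x))
           \<le> limsup (\<lambda>m. ereal (dist_const e m x)) \<and>
         limsup (\<lambda>m. ereal (dist_const e m x)) \<le> ereal (norm x))
       \<longleftrightarrow> comparable (lower_democracy e) (upper_democracy e)) \<and>
     (monotone_basis e es \<and> filterlim (lower_democracy e) at_top sequentially
       \<longrightarrow> (\<forall>x. (\<lambda>m. dist_const e m x) \<longlonglongrightarrow> norm x))"
proof -
  interpret signed: signed_basis e es "{\<epsilon>. \<forall>n. \<bar>\<epsilon> n\<bar> = 1}"
  proof unfold_locales
    have "(\<lambda>_. 1) \<in> {\<epsilon> :: nat \<Rightarrow> real. \<forall>n. \<bar>\<epsilon> n\<bar> = 1}" by simp
    then show "{\<epsilon> :: nat \<Rightarrow> real. \<forall>n. \<bar>\<epsilon> n\<bar> = 1} \<noteq> {}"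
      by (metis empty_iff)
  qed (simp_all add: assms)
  interpret unsigned: signed_basis e es "{\<lambda>_. 1}"
    by unfold_locales (simp_all add: assms fun_eq_iff)
  show ?thesis
    using signed.estimate_iff_comparable signed.monotone_distance_tendsto_norm
      unsigned.estimate_iff_comparable unsigned.monotone_distance_tendsto_norm
    unfolding family_all_signs family_constant_sign by (intro conjI impI allI) simp_all
qed

end
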